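(* Let $(a(n))_{n\ge 0}$ be the integer sequence defined by $$\sum_{n=0}^{\infty} a(n)\,x^n = \frac{3+2x^2}{1+2x^2+2x^3},$$ equivalently $a(1)=0$, $a(2)=-4$, $a(3)=-6$, and $a(n)=-2a(n-2)-2a(n-3)$ for all $n>3$. Then for every prime $p$, $$a(p)\equiv 0 \pmod p.$$ Furthermore, all members of the following infinite families are pseudoprimes for this test, i.e. are composite integers $m$ satisfying $a(m)\equiv 0 \pmod m$: $$\{2^i : i\ge 2\},\qquad \{3\cdot 2^{4i} : i\ge 2\},\qquad \{11\cdot 2^{18i} : i\ge 2\},\qquad \{13\cdot 2^{17+20i} : i\ge 2\},$$ where $i$ ranges over integers. *)

theory Defs
  imports
    "HOL-Computational_Algebra.Formal_Power_Series"
    "HOL-Computational_Algebra.Primes"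
    "HOL-Number_Theory.Cong"
begin

(* The value 3 at 0 is the constant coefficient of the generating function. With it
   the recurrence also gives the value at 3, namely - 2 * 0 - 2 * 3 = - 6. *)
fun seq_a :: "nat \<Rightarrow> int" where
  "seq_a 0 = 3"
| "seq_a (Suc 0) = 0"
| "seq_a (Suc (Suc 0)) = - 4"
| "seq_a (Suc (Suc (Suc n))) = - 2 * seq_a (Suc n) - 2 * seq_a n"

definition composite :: "nat \<Rightarrow> bool" where
  "composite m \<longleftrightarrow> m > 1 \<and> \<not> prime m"

definition pseudoprime :: "nat \<Rightarrow> bool" where
  "pseudoprime m \<longleftrightarrow> composite m \<and> [seq_a m = 0] (mod int m)"

end

theory Submission
  imports Defs
begin

text \<open>
  Put \<open>u = 2 X\<^sup>2 + 2 X\<^sup>3\<close> and \<open>A = \<Sum> a(n) X^n\<close>. Then \<open>(1 + u) (3 - A) = X u'\<close>, that is, \<open>3 - A\<close> is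
  the logarithmic derivative \<open>X (ln (1 + u))'\<close>. In its expansion \<open>\<Sum>\<^sub>k X u' (-u)^k\<close> the \<open>k\<close>-th term times \<open>k + 1\<close> is
  \<open>-X ((-u)^(k+1))'\<close>, whose coefficient at \<open>X^p\<close> is a multiple of \<open>p\<close>. Since \<open>u\<close> has order 2, only terms with
  \<open>k + 1 < p\<close> reach \<open>X^p\<close>, and there \<open>k + 1\<close> is invertible modulo \<open>p\<close>.

  For a number \<open>q \<cdot> 2^k\<close>, divisibility by \<open>2^k\<close> is automatic, because \<open>2^\<lceil>n/3\<rceil>\<close> divides \<open>a(n)\<close> (the
  characteristic polynomial is Eisenstein at 2). Divisibility by \<open>q\<close> follows from the period of \<open>a\<close> modulo \<open>q\<close>, which
  is 13, 665 and 2196 for \<open>q = 3, 11, 13\<close>.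
\<close>

section \<open>Prime coefficients of logarithmic derivatives\<close>

text \<open>The finite geometric series with its exact remainder, so that no inverse of
  \<open>1 + u\<close> and no infinite sum enters.\<close>

lemma geometric_fps_expansion:
  fixes u B C :: "'a::comm_ring_1 fps"
  assumes "B * (1 + u) = C"
  shows "B = (\<Sum>k<N. C * (- u) ^ k) + B * (- u) ^ N"
proof (induction N)
  case (Suc N)
  have "B * (- u) ^ N = C * (- u) ^ N + B * (- u) ^ Suc N"
    unfolding assms[symmetric] by (simp add: algebra_simps)
  with Suc.IH show ?case by (simp add: algebra_simps)
qed simp

lemma prime_dvd_log_deriv_nth:
  fixes u B :: "int fps"
  assumes p: "prime p"
    and u: "u = fps_X ^ 2 * v"
    and B: "B * (1 + u) = fps_X * fps_deriv u"
  shows "int p dvd fps_nth B p"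
proof -
  \<comment> \<open>For \<open>k < N\<close> the factor \<open>k + 1\<close> is less than
    \<open>p\<close>, and the remainder after \<open>N\<close> terms has order at least
    \<open>2 N + 2 = 2 p\<close>.\<close>
  define N where "N = p - 1"
  have p2: "p \<ge> 2" using p by (rule prime_ge_2_nat)
  have deriv: "fps_deriv u = fps_X * (2 * v + fps_X * fps_deriv v)"
    unfolding u by (simp add: power2_eq_square algebra_simps)
  define w where "w = 2 * v + fps_X * fps_deriv v"
  have B': "B * (1 + u) = fps_X ^ 2 * w"
    by (simp add: B deriv w_def power2_eq_square mult.assoc)
  have summand: "int p dvd fps_nth (fps_X * fps_deriv u * (- u) ^ k) p" if "k < N" for k
  proof -
    have "of_nat (Suc k) * (fps_X * fps_deriv u * (- u) ^ k) = - (fps_X * fps_deriv ((- u) ^ Suc k))"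
      by (subst fps_deriv_power') (simp add: algebra_simps)
    then have "fps_nth (of_nat (Suc k) * (fps_X * fps_deriv u * (- u) ^ k)) p
        = - (int p * fps_nth ((- u) ^ Suc k) p)"
      using p2 by (simp del: of_nat_Suc power_Suc)
    then have "int (Suc k) * fps_nth (fps_X * fps_deriv u * (- u) ^ k) p
        = - (int p * fps_nth ((- u) ^ Suc k) p)"
      by (simp only: fps_of_nat[symmetric] fps_mult_left_const_nth)
    then have "int p dvd int (Suc k) * fps_nth (fps_X * fps_deriv u * (- u) ^ k) p"
      by (metis dvd_minus_iff dvd_triv_left)
    moreover have "\<not> int p dvd int (Suc k)"
      using that by (auto simp del: of_nat_Suc simp: int_dvd_int_iff N_def dest!: dvd_imp_le)
    ultimately show ?thesis
      using p prime_dvd_mult_iff[of "int p"] by auto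
  qed
  have expansion: "B = (\<Sum>k<N. fps_X * fps_deriv u * (- u) ^ k) + B * (- u) ^ N"
    using B by (rule geometric_fps_expansion)
  have "B * (- u) ^ N = fps_X ^ (2 * N) * (B * (- v) ^ N)"
    unfolding u minus_mult_right power_mult_distrib power_mult by (rule mult.left_commute)
  \<comment> \<open>This factor is decisive at \<open>p = 2\<close>, where \<open>(- u) ^ N\<close>
    alone may already reach \<open>X^p\<close>.\<close>
  moreover have "\<exists>C. B = fps_X ^ 2 * C"
  proof -
    have "B = fps_X ^ 2 * (w - v * B)"
      using B' by (simp add: u algebra_simps)
    then show ?thesis by blast
  qed
  then obtain C where "B = fps_X ^ 2 * C" ..
  ultimately have "B * (- u) ^ N = fps_X ^ (2 * N + 2) * (C * (- v) ^ N)"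
    by (simp add: power_add algebra_simps power2_eq_square)
  moreover have "p < 2 * N + 2" using p2 by (simp add: N_def)
  ultimately have "fps_nth (B * (- u) ^ N) p = 0"
    by (simp only: fps_X_power_mult_nth if_True)
  then have "fps_nth B p = (\<Sum>k<N. fps_nth (fps_X * fps_deriv u * (- u) ^ k) p)"
    by (subst expansion) (simp add: fps_sum_nth)
  then show ?thesis
    using summand by (auto intro: dvd_sum)
qed

section \<open>The generating function\<close>

text \<open>Cleared of denominators, the identity serves both \<open>int\<close>, for divisibility,
  and \<open>rat\<close>, for the quotient.\<close>

lemma seq_a_generating_function:
  "Abs_fps (\<lambda>n. of_int (seq_a n)) * (1 + 2 * fps_X ^ 2 + 2 * fps_X ^ 3)
    = (3 + 2 * fps_X ^ 2 :: 'a::comm_ring_1 fps)"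
proof (rule fps_ext)
  fix n
  define A :: "'a fps" where "A = Abs_fps (\<lambda>n. of_int (seq_a n))"
  have A: "A * (1 + 2 * fps_X ^ 2 + 2 * fps_X ^ 3)
      = A + fps_const 2 * (fps_X ^ 2 * A) + fps_const 2 * (fps_X ^ 3 * A)"
    by (simp add: algebra_simps numeral_fps_const)
  have nth: "fps_nth (A * (1 + 2 * fps_X ^ 2 + 2 * fps_X ^ 3)) n
      = of_int (seq_a n) + 2 * (if n < 2 then 0 else of_int (seq_a (n - 2)))
        + 2 * (if n < 3 then 0 else of_int (seq_a (n - 3)))"
    unfolding A by (simp add: fps_X_power_mult_nth A_def)
  have rhs: "fps_nth (3 + 2 * fps_X ^ 2 :: 'a fps) n
      = (if n = 0 then 3 else 0) + 2 * (if n = 2 then 1 else 0)"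
    by (simp add: numeral_fps_const)
  consider "n = 0" | "n = 1" | "n = 2" | m where "n = Suc (Suc (Suc m))"
    by (metis One_nat_def Suc_1 not0_implies_Suc)
  then have "fps_nth (A * (1 + 2 * fps_X ^ 2 + 2 * fps_X ^ 3)) n
      = fps_nth (3 + 2 * fps_X ^ 2 :: 'a fps) n"
    unfolding nth rhs by cases (auto simp: numeral_2_eq_2 eval_nat_numeral)
  then show "fps_nth (Abs_fps (\<lambda>n. of_int (seq_a n)) * (1 + 2 * fps_X ^ 2 + 2 * fps_X ^ 3)) n
      = fps_nth (3 + 2 * fps_X ^ 2 :: 'a fps) n"
    by (simp add: A_def)
qed

lemma prime_dvd_seq_a:
  assumes "prime p"
  shows "int p dvd seq_a p"
proof -
  define A :: "int fps" where "A = Abs_fps (\<lambda>n. of_int (seq_a n))"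
  define u :: "int fps" where "u = fps_X ^ 2 * (2 + 2 * fps_X)"
  have u': "1 + u = 1 + 2 * fps_X ^ 2 + 2 * fps_X ^ 3"
    by (simp add: u_def algebra_simps eval_nat_numeral)
  have A: "A * (1 + u) = 3 + 2 * fps_X ^ 2"
    unfolding u' A_def by (rule seq_a_generating_function)
  have "(3 - A) * (1 + u) = 3 * (1 + u) - (3 + 2 * fps_X ^ 2)"
    by (simp only: left_diff_distrib A)
  also have "\<dots> = fps_X * fps_deriv u"
    by (simp add: u_def eval_nat_numeral fps_deriv_power algebra_simps)
  finally have "int p dvd fps_nth (3 - A) p"
    by (rule prime_dvd_log_deriv_nth[OF assms u_def])
  moreover have "fps_nth (3 - A) p = - seq_a p"
    using prime_gt_0_nat[OF assms] by (simp add: A_def numeral_fps_const)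
  ultimately show ?thesis by simp
qed

section \<open>Divisibility by powers of two\<close>

text \<open>The exponent grows by one when the index grows by three, matching the factor 2 that the
  recurrence supplies.\<close>

lemma power2_dvd_seq_a: "2 ^ ((n + 2) div 3) dvd seq_a n"
proof (induction n rule: seq_a.induct)
  case (4 n)
  have "(2::int) ^ Suc ((n + 2) div 3) dvd 2 * seq_a n"
    using 4(2) by simp
  moreover have "(2::int) ^ Suc ((n + 2) div 3) dvd 2 * seq_a (Suc n)"
  proof -
    have "(2::int) ^ ((n + 2) div 3) dvd 2 ^ ((Suc n + 2) div 3)"
      by (rule le_imp_power_dvd) (rule div_le_mono, simp)
    then show ?thesis using 4(1) by (auto intro: dvd_trans)
  qed
  moreover have "(Suc (Suc (Suc n)) + 2) div 3 = Suc ((n + 2) div 3)"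
    by simp
  ultimately show ?case by (simp add: dvd_diff)
qed auto

lemma power2_dvd_seq_a_mult:
  assumes "2 \<le> k" "0 < q"
  shows "2 ^ k dvd seq_a (q * 2 ^ k)"
proof -
  \<comment> \<open>Equality holds at \<open>k = 2\<close>; afterwards each step adds 3 on the left
    and at least 4 on the right.\<close>
  have "3 * k \<le> 2 ^ k + 2"
    using \<open>2 \<le> k\<close>
  proof (induction k rule: dec_induct)
    case (step n)
    have "(4::nat) \<le> 2 ^ n"
      using power_increasing[OF step.hyps(1), of "2::nat"] by simp
    with step.IH show ?case by simp
  qed simp
  also have "\<dots> \<le> q * 2 ^ k + 2"
    using \<open>0 < q\<close> by simp
  finally have "k \<le> (q * 2 ^ k + 2) div 3" by linarith
  then show ?thesis
    by (rule dvd_trans[OF le_imp_power_dvd power2_dvd_seq_a])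
qed

section \<open>Periodicity modulo an odd factor\<close>

text \<open>The recurrence as a map on three consecutive residues: a period is a return to the
  initial state, checked with small numbers.\<close>

definition step_mod :: "int \<Rightarrow> int \<times> int \<times> int \<Rightarrow> int \<times> int \<times> int" where
  "step_mod m = (\<lambda>(x, y, z). (y, z, (- 2 * y - 2 * x) mod m))"

lemma step_mod_simp [simp]: "step_mod m (x, y, z) = (y, z, (- 2 * y - 2 * x) mod m)"
  by (simp add: step_mod_def)

lemma funpow_step_mod:
  "(step_mod m ^^ n) (3 mod m, 0, - 4 mod m)
    = (seq_a n mod m, seq_a (Suc n) mod m, seq_a (Suc (Suc n)) mod m)"
proof (induction n)
  case (Suc n)
  have "(- 2 * (seq_a (Suc n) mod m) - 2 * (seq_a n mod m)) mod m
      = (- 2 * seq_a (Suc n) - 2 * seq_a n) mod m"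
    by (intro mod_diff_cong mod_mult_right_eq)
  then show ?case
    unfolding funpow.simps o_apply Suc.IH step_mod_simp seq_a.simps by (rule arg_cong)
qed simp

lemma seq_a_mod_periodic:
  assumes "(step_mod m ^^ T) (3 mod m, 0, - 4 mod m) = (3 mod m, 0, - 4 mod m)"
  shows "seq_a n mod m = seq_a (n mod T) mod m"
  using funpow_mod_eq[OF assms, of n] unfolding funpow_step_mod prod.inject by (elim conjE, elim sym)

text \<open>Putting \<open>f\<close> innermost lets \<open>simp\<close> evaluate the state before
  the next iteration.\<close>

lemma funpow_numeral_apply:
  "(f ^^ numeral k) x = (f ^^ pred_numeral k) (f x)"
  by (simp add: numeral_eq_Suc funpow_swap1)

text \<open>The polynomial \<open>x^3 + 2 x + 2\<close> is irreducible modulo 3, 11 and 13, so the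
  periods divide \<open>q^3 - 1\<close>: \<open>13 = (3^3 - 1) / 2\<close>,
  \<open>665 = (11^3 - 1) / 2\<close>, \<open>2196 = 13^3 - 1\<close>.\<close>

lemma seq_a_mod_3_period: "(step_mod 3 ^^ 13) (3 mod 3, 0, - 4 mod 3) = (3 mod 3, 0, - 4 mod 3)"
  by (simp add: funpow_numeral_apply)

lemma seq_a_mod_11_period:
  "(step_mod 11 ^^ 665) (3 mod 11, 0, - 4 mod 11) = (3 mod 11, 0, - 4 mod 11)"
  by (simp add: funpow_numeral_apply)

lemma seq_a_mod_13_period:
  "(step_mod 13 ^^ 2196) (3 mod 13, 0, - 4 mod 13) = (3 mod 13, 0, - 4 mod 13)"
  by (simp add: funpow_numeral_apply)

lemma dvd_seq_aI:
  assumes "(step_mod m ^^ n) (3 mod m, 0, - 4 mod m) = (0, s)"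
  shows "m dvd seq_a n"
  using assms unfolding funpow_step_mod prod.inject by (blast intro: mod_0_imp_dvd)

lemma seq_a_dvd_11: "11 dvd seq_a 11" "11 dvd seq_a 144"
  by (rule dvd_seq_aI, simp add: funpow_numeral_apply)+

lemma seq_a_dvd_13: "13 dvd seq_a 44" "13 dvd seq_a 1580" "13 dvd seq_a 2036"
  by (rule dvd_seq_aI, simp add: funpow_numeral_apply)+

lemma seq_a_dvd_3: "3 dvd seq_a 1" "3 dvd seq_a 3" "3 dvd seq_a 9"
  by (rule dvd_seq_aI, simp add: funpow_numeral_apply)+

text \<open>Only the index modulo \<open>T\<close> matters, and multiplication by \<open>c\<close>
  keeps it in \<open>R\<close>; a finite \<open>R\<close> thus settles all \<open>i\<close>.\<close>

lemma dvd_seq_a_mult_power: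
  assumes period: "(step_mod m ^^ T) (3 mod m, 0, - 4 mod m) = (3 mod m, 0, - 4 mod m)"
    and start: "a mod T \<in> R"
    and closed: "\<And>r. r \<in> R \<Longrightarrow> c * r mod T \<in> R"
    and dvd: "\<And>r. r \<in> R \<Longrightarrow> m dvd seq_a r"
  shows "m dvd seq_a (a * c ^ i)"
proof -
  have "a * c ^ i mod T \<in> R"
  proof (induction i)
    case (Suc i)
    have "a * c ^ Suc i mod T = c * (a * c ^ i mod T) mod T"
      unfolding mod_mult_right_eq power_Suc by (simp only: mult.left_commute)
    with closed[OF Suc.IH] show ?case by simp
  qed (simp add: start)
  then have "m dvd seq_a (a * c ^ i mod T)"
    by (rule dvd)
  then show ?thesis
    unfolding dvd_eq_mod_eq_0 seq_a_mod_periodic[OF period, of "a * c ^ i"] .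
qed

text \<open>Modulo 13, \<open>2^4\<close> is 3, whose powers are 1, 3, 9.\<close>

lemma dvd_seq_a_3: "3 dvd seq_a (3 * 2 ^ (4 * i))"
  unfolding power_mult
  by (rule dvd_seq_a_mult_power[OF seq_a_mod_3_period, where R = "{1, 3, 9}"])
    (auto simp: seq_a_dvd_3)

text \<open>Multiplication by \<open>2^18\<close> modulo 665 swaps 11 and 144.\<close>

lemma dvd_seq_a_11: "11 dvd seq_a (11 * 2 ^ (18 * i))"
  unfolding power_mult
  by (rule dvd_seq_a_mult_power[OF seq_a_mod_11_period, where R = "{11, 144}"])
    (auto simp: seq_a_dvd_11)

text \<open>Modulo 2196, \<open>13 * 2^17\<close> is 2036, and \<open>2^20\<close> permutes 2036,
  44, 1580 cyclically.\<close>

lemma dvd_seq_a_13: "13 dvd seq_a (13 * 2 ^ (17 + 20 * i))"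
  unfolding power_add power_mult mult.assoc[symmetric]
  by (rule dvd_seq_a_mult_power[OF seq_a_mod_13_period, where R = "{44, 1580, 2036}"])
    (auto simp: seq_a_dvd_13)

section \<open>Pseudoprimes\<close>

lemma composite_mult: "1 < a \<Longrightarrow> 1 < b \<Longrightarrow> composite (a * b)"
  unfolding composite_def by (metis less_1_mult nat_neq_iff prime_product)

lemma pseudoprime_mult_power2:
  assumes "odd q" "1 < q" "2 \<le> k" "int q dvd seq_a (q * 2 ^ k)"
  shows "pseudoprime (q * 2 ^ k)"
proof -
  have "1 < (2::nat) ^ k"
    using \<open>2 \<le> k\<close> by (intro one_less_power) auto
  then have "composite (q * 2 ^ k)"
    using \<open>1 < q\<close> by (intro composite_mult)
  moreover have "coprime (int q) (2 ^ k)"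
    using \<open>odd q\<close> by simp
  then have "int q * 2 ^ k dvd seq_a (q * 2 ^ k)"
    using assms(4) power2_dvd_seq_a_mult[of k q] \<open>1 < q\<close> \<open>2 \<le> k\<close> by (intro divides_mult) auto
  ultimately show ?thesis
    by (simp add: pseudoprime_def cong_0_iff)
qed

lemma pseudoprime_power2:
  assumes "2 \<le> k"
  shows "pseudoprime (2 ^ k)"
proof -
  have "composite (2 * 2 ^ (k - 1))"
    using assms by (intro composite_mult one_less_power) auto
  moreover have "2 * 2 ^ (k - 1) = (2::nat) ^ k"
    using assms by (simp flip: power_Suc)
  ultimately show ?thesis
    using power2_dvd_seq_a_mult[of k 1] assms by (simp add: pseudoprime_def cong_0_iff)
qed

theorem theorem4:
  shows "Abs_fps (\<lambda>n. of_int (seq_a n)) =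
           ((3 + 2 * fps_X ^ 2) / (1 + 2 * fps_X ^ 2 + 2 * fps_X ^ 3) :: rat fps)
    \<and> (seq_a 1 = 0 \<and> seq_a 2 = - 4 \<and> seq_a 3 = - 6 \<and>
         (\<forall>n>3. seq_a n = - 2 * seq_a (n - 2) - 2 * seq_a (n - 3)))
    \<and> (\<forall>p::nat. prime p \<longrightarrow> [seq_a p = 0] (mod int p))
    \<and> (\<forall>i::nat. i \<ge> 2 \<longrightarrow> pseudoprime (2 ^ i))
    \<and> (\<forall>i::nat. i \<ge> 2 \<longrightarrow> pseudoprime (3 * 2 ^ (4 * i)))
    \<and> (\<forall>i::nat. i \<ge> 2 \<longrightarrow> pseudoprime (11 * 2 ^ (18 * i)))
    \<and> (\<forall>i::nat. i \<ge> 2 \<longrightarrow> pseudoprime (13 * 2 ^ (17 + 20 * i)))"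
proof (intro conjI allI impI)
  \<comment> \<open>A nonzero denominator cancels from the product identity.\<close>
  have "fps_nth (1 + 2 * fps_X ^ 2 + 2 * fps_X ^ 3 :: rat fps) 0 \<noteq> 0"
    by simp
  then have "(1 + 2 * fps_X ^ 2 + 2 * fps_X ^ 3 :: rat fps) \<noteq> 0"
    by (metis fps_zero_nth)
  then show "Abs_fps (\<lambda>n. of_int (seq_a n)) =
      ((3 + 2 * fps_X ^ 2) / (1 + 2 * fps_X ^ 2 + 2 * fps_X ^ 3) :: rat fps)"
    by (simp flip: seq_a_generating_function)
next
  fix n :: nat
  assume "3 < n"
  then obtain m where "n = Suc (Suc (Suc m))"
    by (metis add_Suc add_0 less_imp_Suc_add numeral_3_eq_3)
  then show "seq_a n = - 2 * seq_a (n - 2) - 2 * seq_a (n - 3)"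
    by (simp add: eval_nat_numeral)
next
  show "seq_a 2 = - 4" "seq_a 3 = - 6"
    by (simp_all add: numeral_2_eq_2 numeral_3_eq_3)
next
  fix p :: nat
  assume "prime p"
  then show "[seq_a p = 0] (mod int p)"
    by (simp add: cong_0_iff prime_dvd_seq_a)
next
  fix i :: nat
  assume "2 \<le> i"
  then show "pseudoprime (2 ^ i)"
    by (rule pseudoprime_power2)
  show "pseudoprime (3 * 2 ^ (4 * i))"
    by (rule pseudoprime_mult_power2) (use \<open>2 \<le> i\<close> dvd_seq_a_3 in auto)
  show "pseudoprime (11 * 2 ^ (18 * i))"
    by (rule pseudoprime_mult_power2) (use \<open>2 \<le> i\<close> dvd_seq_a_11 in auto)
  show "pseudoprime (13 * 2 ^ (17 + 20 * i))"
    by (rule pseudoprime_mult_power2) (use \<open>2 \<le> i\<close> dvd_seq_a_13 in auto)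
qed simp

end
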